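(* Let $\pi>1$ be a real number and suppose $p\ge q$ (i.e., $(Z_t)_{t\ge 0}$ is a submartingale). Then for every $t\in\mathbb{Z}_{\ge 0}$, $$E[M_t^\pi]\le\left(\frac{\pi}{\pi-1}\right)^{\pi}E[|Z_t|^\pi].$$
   Context: Here $\pi$ is an arbitrary real exponent (not the circle constant), and $\mathbb{Z}_{\ge 0}$ denotes the set of nonnegative integers. Let $\xi_1,\xi_2,\dots$ be i.i.d. random variables on a probability space $(\Omega,\mathcal{F},P)$ with $P(\xi_1=1)=p$, $P(\xi_1=-1)=q$, $P(\xi_1=0)=r$, where $p>0$, $q>0$ (and $r\ge 0$), $p+q+r=1$. The random walk is $Z_0=0$, $Z_{t+1}=Z_t+\xi_{t+1}$ for $t\in\mathbb{Z}_{\ge 0}$, its maximum process is $M_t=\max_{0\le s\le t}Z_s$, and the filtration is the natural one, $\mathcal{F}_t=\sigma(Z_s: s\le t)$. *)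

theory Defs
  imports "HOL-Probability.Probability"
begin

text \<open>The steps are indexed from 1, so the value \<open>\<xi> 0\<close> plays no role.\<close>

primrec walk :: "(nat \<Rightarrow> 'a \<Rightarrow> real) \<Rightarrow> nat \<Rightarrow> 'a \<Rightarrow> real" where
  "walk \<xi> 0 \<omega> = 0"
| "walk \<xi> (Suc t) \<omega> = walk \<xi> t \<omega> + \<xi> (Suc t) \<omega>"

definition running_max :: "(nat \<Rightarrow> 'a \<Rightarrow> real) \<Rightarrow> nat \<Rightarrow> 'a \<Rightarrow> real" where
  "running_max Z t \<omega> = Max ((\<lambda>s. Z s \<omega>) ` {0..t})"

text \<open>
  The steps are only almost surely \<open>{-1, 0, 1}\<close>-valued, which is what
  \<open>p + q + r = 1\<close> expresses. Being identically distributed is implied, since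
  \<open>p\<close>, \<open>q\<close>, \<open>r\<close> do not depend on the index.
\<close>

definition iid_walk_steps ::
    "'a measure \<Rightarrow> real \<Rightarrow> real \<Rightarrow> real \<Rightarrow> (nat \<Rightarrow> 'a \<Rightarrow> real) \<Rightarrow> bool" where
  "iid_walk_steps P p q r \<xi> \<longleftrightarrow>
     p > 0 \<and> q > 0 \<and> r \<ge> 0 \<and> p + q + r = 1 \<and>
     prob_space.indep_vars P (\<lambda>_. borel) \<xi> {1..} \<and>
     (\<forall>i\<ge>1. measure P {\<omega> \<in> space P. \<xi> i \<omega> = 1} = p \<and>
            measure P {\<omega> \<in> space P. \<xi> i \<omega> = -1} = q \<and>
            measure P {\<omega> \<in> space P. \<xi> i \<omega> = 0} = r)"

end

theory Submission
  imports Defs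
begin

text \<open>
  The inequality is Doob's \<open>L\<^sup>\<pi>\<close> inequality. It follows here from an inequality that holds along
  every single path and then only has to be integrated. The tangent (Young) inequality
  \<open>\<pi> a\<^bsup>\<pi>-1\<^esup> b \<le> (\<pi>-1) a\<^bsup>\<pi>\<^esup> + b\<^bsup>\<pi>\<^esup>\<close> is used twice.

  For the first use, consider the potential
  \<open>A\<^sub>i = \<pi> M\<^sub>i\<^bsup>\<pi>-1\<^esup> Z\<^sub>i - (\<pi>-1) M\<^sub>i\<^bsup>\<pi>\<^esup>\<close>. As long as the maximum stays unchanged, it moves by exactly
  \<open>\<pi> M\<^sub>i\<^bsup>\<pi>-1\<^esup> (Z\<^bsub>i+1\<^esub> - Z\<^sub>i)\<close>. When a new maximum \<open>b = Z\<^bsub>i+1\<^esub> = M\<^bsub>i+1\<^esub>\<close> replaces \<open>a = M\<^sub>i\<close>, it moves by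
  that amount plus the Young gap \<open>b\<^bsup>\<pi>\<^esup> + (\<pi>-1) a\<^bsup>\<pi>\<^esup> - \<pi> a\<^bsup>\<pi>-1\<^esup> b \<ge> 0\<close>. Summing over \<open>i\<close> bounds
  \<open>(\<pi>-1) M\<^sub>t\<^bsup>\<pi>\<^esup>\<close> by \<open>\<pi> M\<^sub>t\<^bsup>\<pi>-1\<^esup> Z\<^sub>t\<close> minus \<open>\<pi>\<close> times the discrete stochastic integral of \<open>M\<^bsup>\<pi>-1\<^esup>\<close> against
  \<open>Z\<close> (\<open>running_max_powr_pathwise_bound\<close>). The second use, with \<open>b = \<pi>/(\<pi>-1) \<bar>Z\<^sub>t\<bar>\<close>, turns the product
  \<open>M\<^sub>t\<^bsup>\<pi>-1\<^esup> Z\<^sub>t\<close> into a multiple of \<open>M\<^sub>t\<^bsup>\<pi>\<^esup>\<close> small enough to be absorbed on the left, plus the desired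
  multiple of \<open>\<bar>Z\<^sub>t\<bar>\<^bsup>\<pi>\<^esup>\<close> (\<open>running_max_powr_pathwise_Doob\<close>).

  Probability enters only through the sign of the expected stochastic integral. For the random
  walk, \<open>M\<^sub>i\<close> depends on the first \<open>i\<close> steps only, so \<open>E[M\<^sub>i\<^bsup>\<pi>-1\<^esup> \<xi>\<^bsub>i+1\<^esub>] = E[M\<^sub>i\<^bsup>\<pi>-1\<^esup>] (p - q) \<ge> 0\<close>.
  All terms are integrable because after \<open>t\<close> steps the walk is almost surely bounded by \<open>t\<close>.
\<close>

section \<open>Doob's inequality along a path\<close>

text \<open>
  Young's inequality for the conjugate exponents \<open>s\<close> and \<open>s / (s - 1)\<close>, cleared of denominators.
  The right-hand side minus the left-hand side is the gap between the convex function \<open>x\<^bsup>s\<^esup>\<close> at \<open>b\<close>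
  and its tangent at \<open>a\<close>.
\<close>

lemma powr_tangent_inequality:
  fixes a b s :: real
  assumes "s > 1" "a \<ge> 0" "b \<ge> 0"
  shows "s * a powr (s - 1) * b \<le> (s - 1) * a powr s + b powr s"
proof -
  have "b * a powr (s - 1) \<le> b powr s / s + (a powr (s - 1)) powr (s / (s - 1)) / (s / (s - 1))"
    using assms by (intro Youngs_inequality) (auto simp: field_simps)
  also have "(a powr (s - 1)) powr (s / (s - 1)) = a powr s"
    using assms by (simp add: powr_powr)
  finally have "s * (b * a powr (s - 1)) \<le> s * (b powr s / s + a powr s / (s / (s - 1)))"
    using assms by (intro mult_left_mono) auto
  then show ?thesis
    using assms by (simp add: distrib_left mult_ac)
qed

lemma running_max_0 [simp]: "running_max Z 0 \<omega> = Z 0 \<omega>"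
  by (simp add: running_max_def)

lemma running_max_Suc: "running_max Z (Suc t) \<omega> = max (running_max Z t \<omega>) (Z (Suc t) \<omega>)"
  by (simp add: running_max_def atLeast0_atMost_Suc max.commute)

lemma running_max_upper: "s \<le> t \<Longrightarrow> Z s \<omega> \<le> running_max Z t \<omega>"
  by (simp add: running_max_def)

lemma running_max_least: "(\<And>s. s \<le> t \<Longrightarrow> Z s \<omega> \<le> B) \<Longrightarrow> running_max Z t \<omega> \<le> B"
  by (simp add: running_max_def)

text \<open>
  A discrete substitute for \<open>d(M\<^bsup>s\<^esup>) = s M\<^bsup>s-1\<^esup> dM\<close>: on a continuous path starting at 0,
  \<open>M\<close> grows only while \<open>Z = M\<close>, and equality would hold. A jump past the old maximum costs the gap in the tangent inequality, which has
  the right sign.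
\<close>

lemma running_max_powr_pathwise_bound:
  fixes s :: real
  assumes s: "s > 1" and Z0: "Z 0 \<omega> \<ge> 0"
  shows "(s - 1) * running_max Z t \<omega> powr s
           \<le> s * (running_max Z t \<omega> powr (s - 1) * Z t \<omega>
                  - (\<Sum>i<t. running_max Z i \<omega> powr (s - 1) * (Z (Suc i) \<omega> - Z i \<omega>)))"
proof (induction t)
  case 0
  have "Z 0 \<omega> powr (s - 1) * Z 0 \<omega> = Z 0 \<omega> powr s"
    using Z0 by (cases "Z 0 \<omega> = 0") (auto simp: powr_diff)
  then show ?case
    by (simp add: left_diff_distrib)
next
  case (Suc t)
  define a where "a = running_max Z t \<omega>"
  define b where "b = Z (Suc t) \<omega>"
  have a: "a \<ge> 0"
    using running_max_upper[of 0 t Z \<omega>] Z0 by (simp add: a_def)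
  show ?case
  proof (cases "b \<le> a")
    case True
    then have "running_max Z (Suc t) \<omega> = a"
      by (simp add: running_max_Suc a_def b_def)
    then show ?thesis
      using Suc.IH by (simp add: a_def algebra_simps)
  next
    case False
    then have max: "running_max Z (Suc t) \<omega> = b"
      by (simp add: running_max_Suc a_def b_def)
    have "b powr (s - 1) * b = b powr s"
      using False a by (simp add: powr_diff)
    moreover have "s * a powr (s - 1) * b \<le> (s - 1) * a powr s + b powr s"
      using s a False by (intro powr_tangent_inequality) auto
    ultimately show ?thesis
      using Suc.IH by (simp add: max a_def[symmetric] b_def[symmetric] algebra_simps)
  qed
qed

lemma running_max_powr_pathwise_Doob:
  fixes s :: real
  assumes s: "s > 1" and Z0: "Z 0 \<omega> \<ge> 0"
  shows "running_max Z t \<omega> powr s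
           \<le> (s / (s - 1)) powr s * \<bar>Z t \<omega>\<bar> powr s
              - s * (s / (s - 1)) * (\<Sum>i<t. running_max Z i \<omega> powr (s - 1) * (Z (Suc i) \<omega> - Z i \<omega>))"
    (is "?m powr s \<le> _ - _ * ?I")
proof -
  define C where "C = s / (s - 1)"
  have m: "?m \<ge> 0"
    using running_max_upper[of 0 t Z \<omega>] Z0 by simp
  have C: "C > 0" "C * (s - 1) = s"
    using s by (auto simp: C_def)
  \<comment> \<open>The scaling by \<open>C\<close> makes the coefficient of \<open>?m powr s\<close> left over after absorption equal to 1.\<close>
  have young: "s * ?m powr (s - 1) * (C * \<bar>Z t \<omega>\<bar>) \<le> (s - 1) * ?m powr s + (C * \<bar>Z t \<omega>\<bar>) powr s"
    using s m C by (intro powr_tangent_inequality) auto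
  have "s * ?m powr s = C * ((s - 1) * ?m powr s)"
    by (simp only: mult.assoc[symmetric] C)
  also have "\<dots> \<le> C * (s * (?m powr (s - 1) * Z t \<omega> - ?I))"
    using C s Z0 by (intro mult_left_mono running_max_powr_pathwise_bound) auto
  also have "\<dots> = s * ?m powr (s - 1) * (C * Z t \<omega>) - s * C * ?I"
    by (simp add: right_diff_distrib mult_ac)
  also have "s * ?m powr (s - 1) * (C * Z t \<omega>) \<le> s * ?m powr (s - 1) * (C * \<bar>Z t \<omega>\<bar>)"
    using C s by (intro mult_left_mono) auto
  also note young
  also have "(C * \<bar>Z t \<omega>\<bar>) powr s = C powr s * \<bar>Z t \<omega>\<bar> powr s"
    by (rule powr_mult)
  finally have "?m powr s \<le> C powr s * \<bar>Z t \<omega>\<bar> powr s - s * C * ?I"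
    by (simp add: left_diff_distrib)
  then show ?thesis
    by (simp only: C_def)
qed

section \<open>Integrating the path inequality\<close>

lemma borel_measurable_running_max:
  assumes "\<And>s. s \<le> t \<Longrightarrow> Z s \<in> borel_measurable M"
  shows "running_max Z t \<in> borel_measurable M"
  using assms
proof (induction t)
  case 0
  then show ?case by simp
next
  case (Suc t)
  have "(\<lambda>\<omega>. max (running_max Z t \<omega>) (Z (Suc t) \<omega>)) \<in> borel_measurable M"
    using Suc by (intro borel_measurable_max) auto
  then show ?case
    by (simp add: running_max_Suc[abs_def])
qed

text \<open>
  The hypothesis on the increments is the submartingale property tested only against the weights
  that occur in the path inequality; asking for it in this form avoids conditional expectations. The
  bound \<open>B\<close> makes every term integrable.
\<close>

lemma (in finite_measure) Doob_Lp_running_max: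
  fixes Z :: "nat \<Rightarrow> 'a \<Rightarrow> real" and s B :: real
  assumes s: "s > 1"
    and meas [measurable]: "\<And>i. Z i \<in> borel_measurable M"
    and Z0: "\<And>\<omega>. Z 0 \<omega> \<ge> 0"
    and bdd: "\<And>i. i \<le> t \<Longrightarrow> AE \<omega> in M. \<bar>Z i \<omega>\<bar> \<le> B"
    and incr: "\<And>i. i < t \<Longrightarrow>
      (\<integral>\<omega>. running_max Z i \<omega> powr (s - 1) * (Z (Suc i) \<omega> - Z i \<omega>) \<partial>M) \<ge> 0"
  shows "(\<integral>\<omega>. running_max Z t \<omega> powr s \<partial>M) \<le> (s / (s - 1)) powr s * (\<integral>\<omega>. \<bar>Z t \<omega>\<bar> powr s \<partial>M)"
proof -
  have [measurable]: "running_max Z i \<in> borel_measurable M" for i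
    by (intro borel_measurable_running_max meas)
  have all_bdd: "AE \<omega> in M. \<forall>i\<in>{..t}. \<bar>Z i \<omega>\<bar> \<le> B"
    using bdd by (intro AE_finite_allI) auto
  have max_bdd: "AE \<omega> in M. 0 \<le> running_max Z i \<omega> \<and> running_max Z i \<omega> \<le> B" if "i \<le> t" for i
    using all_bdd
  proof eventually_elim
    case (elim \<omega>)
    have "running_max Z i \<omega> \<le> B"
      using elim that by (intro running_max_least) (meson abs_le_D1 atMost_iff order_trans)
    then show ?case
      using Z0[of \<omega>] running_max_upper[of 0 i Z \<omega>] by auto
  qed
  have max_int: "integrable M (\<lambda>\<omega>. running_max Z t \<omega> powr s)"
  proof (rule integrable_const_bound)
    show "AE \<omega> in M. norm (running_max Z t \<omega> powr s) \<le> B powr s"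
      using max_bdd[OF order_refl] by eventually_elim (use s in \<open>auto intro: powr_mono2\<close>)
  qed measurable
  have Z_int: "integrable M (\<lambda>\<omega>. \<bar>Z t \<omega>\<bar> powr s)"
  proof (rule integrable_const_bound)
    show "AE \<omega> in M. norm (\<bar>Z t \<omega>\<bar> powr s) \<le> B powr s"
      using bdd[OF order_refl] by eventually_elim (use s in \<open>auto intro: powr_mono2\<close>)
  qed measurable
  have incr_int: "integrable M (\<lambda>\<omega>. running_max Z i \<omega> powr (s - 1) * (Z (Suc i) \<omega> - Z i \<omega>))"
    if "i < t" for i
  proof (rule integrable_const_bound)
    from that have i: "i \<le> t" "Suc i \<le> t"
      by auto
    show "AE \<omega> in M. norm (running_max Z i \<omega> powr (s - 1) * (Z (Suc i) \<omega> - Z i \<omega>))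
        \<le> B powr (s - 1) * (2 * B)"
      using max_bdd[OF i(1)] bdd[OF i(1)] bdd[OF i(2)]
    proof eventually_elim
      case (elim \<omega>)
      then show ?case
        using s by (auto simp: abs_mult intro!: mult_mono powr_mono2)
    qed
  qed measurable
  let ?I = "\<lambda>\<omega>. \<Sum>i<t. running_max Z i \<omega> powr (s - 1) * (Z (Suc i) \<omega> - Z i \<omega>)"
  have I_int: "integrable M ?I"
    using incr_int by (intro Bochner_Integration.integrable_sum) auto
  define C where "C = s / (s - 1)"
  have "C > 0"
    using s by (simp add: C_def)
  have "(\<integral>\<omega>. running_max Z t \<omega> powr s \<partial>M)
      \<le> (\<integral>\<omega>. C powr s * \<bar>Z t \<omega>\<bar> powr s - s * C * ?I \<omega> \<partial>M)"
    unfolding C_def using max_int Z_int I_int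
    by (intro integral_mono running_max_powr_pathwise_Doob s Z0 Bochner_Integration.integrable_diff
        integrable_mult_right)
  also have "\<dots> = C powr s * (\<integral>\<omega>. \<bar>Z t \<omega>\<bar> powr s \<partial>M) - s * C * (\<integral>\<omega>. ?I \<omega> \<partial>M)"
    using Z_int I_int by simp
  also have "(\<integral>\<omega>. ?I \<omega> \<partial>M)
      = (\<Sum>i<t. \<integral>\<omega>. running_max Z i \<omega> powr (s - 1) * (Z (Suc i) \<omega> - Z i \<omega>) \<partial>M)"
    using incr_int by (intro Bochner_Integration.integral_sum) auto
  also have "C powr s * (\<integral>\<omega>. \<bar>Z t \<omega>\<bar> powr s \<partial>M) - s * C * \<dots> \<le> C powr s * (\<integral>\<omega>. \<bar>Z t \<omega>\<bar> powr s \<partial>M)"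
    using s \<open>C > 0\<close> incr by (auto intro!: mult_nonneg_nonneg sum_nonneg)
  finally show ?thesis
    by (simp only: C_def)
qed

section \<open>The random walk\<close>

lemma borel_measurable_walk:
  assumes "\<And>k. 1 \<le> k \<Longrightarrow> k \<le> t \<Longrightarrow> \<xi> k \<in> borel_measurable M"
  shows "walk \<xi> t \<in> borel_measurable M"
  using assms
proof (induction t)
  case 0
  then show ?case by (simp add: walk.simps(1)[abs_def])
next
  case (Suc t)
  have "(\<lambda>\<omega>. walk \<xi> t \<omega> + \<xi> (Suc t) \<omega>) \<in> borel_measurable M"
    using Suc by (intro borel_measurable_add) auto
  then show ?case
    by (simp add: walk.simps(2)[abs_def])
qed

lemma walk_cong:
  "(\<And>k. 1 \<le> k \<Longrightarrow> k \<le> t \<Longrightarrow> \<xi> k \<omega> = \<eta> k \<nu>) \<Longrightarrow> walk \<xi> t \<omega> = walk \<eta> t \<nu>"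
  by (induction t) auto

lemma abs_walk_le:
  assumes "\<And>k. 1 \<le> k \<Longrightarrow> k \<le> t \<Longrightarrow> \<bar>\<xi> k \<omega>\<bar> \<le> 1"
  shows "\<bar>walk \<xi> t \<omega>\<bar> \<le> real t"
  using assms
proof (induction t)
  case 0
  then show ?case by simp
next
  case (Suc t)
  have "\<bar>walk \<xi> t \<omega>\<bar> \<le> real t" "\<bar>\<xi> (Suc t) \<omega>\<bar> \<le> 1"
    using Suc by auto
  then show ?case by simp
qed

text \<open>
  Independence of families gives independence of the two blocks of steps \<open>{1..t}\<close> and \<open>{t+1}\<close>, each
  seen as one random variable with values in a product space. On the first product space the walk
  driven by the coordinate functions recovers the original walk, so its maximum is a measurable
  function of the first block.
\<close>

lemma (in prob_space) indep_var_running_max_walk: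
  fixes \<xi> :: "nat \<Rightarrow> 'a \<Rightarrow> real"
  assumes "indep_vars (\<lambda>_. borel) \<xi> {1..}"
  shows "indep_var borel (running_max (walk \<xi>) t) borel (\<xi> (Suc t))"
proof -
  let ?R = "\<lambda>A \<omega>. restrict (\<lambda>i. \<xi> i \<omega>) A"
  let ?max = "running_max (walk (\<lambda>k f. f k)) t"
  have "?max \<in> borel_measurable (PiM {1..t} (\<lambda>_. borel))"
    by (intro borel_measurable_running_max borel_measurable_walk measurable_component_singleton) auto
  moreover have "(\<lambda>f. f (Suc t)) \<in> borel_measurable (PiM {Suc t} (\<lambda>_. borel :: real measure))"
    by (intro measurable_component_singleton) auto
  moreover have "indep_var (PiM {1..t} (\<lambda>_. borel)) (?R {1..t}) (PiM {Suc t} (\<lambda>_. borel)) (?R {Suc t})"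
    by (intro indep_var_restrict[OF assms]) auto
  ultimately have "indep_var borel (?max \<circ> ?R {1..t}) borel ((\<lambda>f. f (Suc t)) \<circ> ?R {Suc t})"
    by (intro indep_var_compose)
  moreover have "walk (\<lambda>k f. f k) s (?R {1..t} \<omega>) = walk \<xi> s \<omega>" if "s \<le> t" for s \<omega>
    using that by (intro walk_cong) auto
  then have "?max \<circ> ?R {1..t} = running_max (walk \<xi>) t"
    by (auto simp: fun_eq_iff running_max_def intro!: arg_cong[where f = Max] image_cong)
  moreover have "(\<lambda>f. f (Suc t)) \<circ> ?R {Suc t} = \<xi> (Suc t)"
    by auto
  ultimately show ?thesis
    by simp
qed

lemma (in prob_space) AE_three_valued:
  fixes X :: "'a \<Rightarrow> real"
  assumes [measurable]: "X \<in> borel_measurable M"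
    and "p + q + r = 1" "prob {\<omega> \<in> space M. X \<omega> = 1} = p"
    "prob {\<omega> \<in> space M. X \<omega> = -1} = q" "prob {\<omega> \<in> space M. X \<omega> = 0} = r"
  shows "AE \<omega> in M. X \<omega> = 1 \<or> X \<omega> = -1 \<or> X \<omega> = 0"
proof -
  let ?E = "\<lambda>x. {\<omega> \<in> space M. X \<omega> = x}"
  have "prob (?E 1 \<union> ?E (-1) \<union> ?E 0) = prob (?E 1 \<union> ?E (-1)) + prob (?E 0)"
    by (rule finite_measure_Union) auto
  also have "prob (?E 1 \<union> ?E (-1)) = prob (?E 1) + prob (?E (-1))"
    by (rule finite_measure_Union) auto
  also have "prob (?E 1) + prob (?E (-1)) + prob (?E 0) = 1"
    using assms by simp
  finally have "AE \<omega> in M. \<omega> \<in> ?E 1 \<union> ?E (-1) \<union> ?E 0"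
    by (rule AE_prob_1)
  then show ?thesis
    by eventually_elim auto
qed

lemma (in prob_space) expectation_three_valued:
  fixes X :: "'a \<Rightarrow> real"
  assumes [measurable]: "X \<in> borel_measurable M"
    and val: "AE \<omega> in M. X \<omega> = 1 \<or> X \<omega> = -1 \<or> X \<omega> = 0"
  shows "expectation X = prob {\<omega> \<in> space M. X \<omega> = 1} - prob {\<omega> \<in> space M. X \<omega> = -1}"
proof -
  let ?E = "\<lambda>x. {\<omega> \<in> space M. X \<omega> = x}"
  have "expectation X = expectation (\<lambda>\<omega>. indicator (?E 1) \<omega> - indicator (?E (-1)) \<omega>)"
  proof (rule integral_cong_AE)
    show "AE \<omega> in M. X \<omega> = indicator (?E 1) \<omega> - indicator (?E (-1)) \<omega>"
      using val AE_space by eventually_elim auto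
  qed measurable
  also have "\<dots> = prob (?E 1) - prob (?E (-1))"
    by (subst Bochner_Integration.integral_diff) (auto simp: emeasure_eq_measure)
  finally show ?thesis .
qed

theorem proposition4:
  fixes P :: "'a measure" and \<xi> :: "nat \<Rightarrow> 'a \<Rightarrow> real"
    and p q r \<pi> :: real and t :: nat
  assumes "prob_space P"
    and "iid_walk_steps P p q r \<xi>"
    and "\<pi> > 1"
    and "p \<ge> q"
  shows "prob_space.expectation P (\<lambda>\<omega>. running_max (walk \<xi>) t \<omega> powr \<pi>)
           \<le> (\<pi> / (\<pi> - 1)) powr \<pi>
               * prob_space.expectation P (\<lambda>\<omega>. \<bar>walk \<xi> t \<omega>\<bar> powr \<pi>)"
proof -
  interpret prob_space P by fact
  have sum1: "p + q + r = 1" and indep: "indep_vars (\<lambda>_. borel) \<xi> {1..}"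
    and law: "\<And>i. i \<ge> 1 \<Longrightarrow> prob {\<omega> \<in> space P. \<xi> i \<omega> = 1} = p"
      "\<And>i. i \<ge> 1 \<Longrightarrow> prob {\<omega> \<in> space P. \<xi> i \<omega> = -1} = q"
      "\<And>i. i \<ge> 1 \<Longrightarrow> prob {\<omega> \<in> space P. \<xi> i \<omega> = 0} = r"
    using assms(2) by (auto simp: iid_walk_steps_def)
  have step_meas: "\<xi> i \<in> borel_measurable P" if "i \<ge> 1" for i
    using indep that by (auto simp: indep_vars_def2)
  have step_val: "AE \<omega> in P. \<xi> i \<omega> = 1 \<or> \<xi> i \<omega> = -1 \<or> \<xi> i \<omega> = 0" if "i \<ge> 1" for i
    using that by (intro AE_three_valued[OF step_meas sum1 law]) auto
  have walk_meas: "walk \<xi> i \<in> borel_measurable P" for i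
    by (intro borel_measurable_walk step_meas)
  have max_meas [measurable]: "running_max (walk \<xi>) i \<in> borel_measurable P" for i
    by (intro borel_measurable_running_max walk_meas)
  have walk_bdd: "AE \<omega> in P. \<bar>walk \<xi> i \<omega>\<bar> \<le> real t" if "i \<le> t" for i
  proof -
    have "AE \<omega> in P. \<forall>k\<in>{1..i}. \<xi> k \<omega> = 1 \<or> \<xi> k \<omega> = -1 \<or> \<xi> k \<omega> = 0"
      using step_val by (intro AE_finite_allI) auto
    then show ?thesis
    proof eventually_elim
      case (elim \<omega>)
      have "\<bar>walk \<xi> i \<omega>\<bar> \<le> real i"
      proof (rule abs_walk_le)
        fix k assume "1 \<le> k" "k \<le> i"
        then show "\<bar>\<xi> k \<omega>\<bar> \<le> 1"
          using elim by (auto dest!: bspec[of _ _ k])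
      qed
      then show ?case
        using that by linarith
    qed
  qed
  have incr: "expectation (\<lambda>\<omega>. running_max (walk \<xi>) i \<omega> powr (\<pi> - 1)
      * (walk \<xi> (Suc i) \<omega> - walk \<xi> i \<omega>)) \<ge> 0" if i: "i < t" for i
  proof -
    have "indep_var borel ((\<lambda>x. x powr (\<pi> - 1)) \<circ> running_max (walk \<xi>) i) borel (id \<circ> \<xi> (Suc i))"
      by (rule indep_var_compose[OF indep_var_running_max_walk[OF indep]]) measurable
    then have ind: "indep_var borel (\<lambda>\<omega>. running_max (walk \<xi>) i \<omega> powr (\<pi> - 1)) borel (\<xi> (Suc i))"
      by (simp add: comp_def)
    have int1: "integrable P (\<lambda>\<omega>. running_max (walk \<xi>) i \<omega> powr (\<pi> - 1))"
    proof (rule integrable_const_bound)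
      have "AE \<omega> in P. \<forall>k\<in>{..i}. \<bar>walk \<xi> k \<omega>\<bar> \<le> real t"
        using walk_bdd i by (intro AE_finite_allI) auto
      then show "AE \<omega> in P. norm (running_max (walk \<xi>) i \<omega> powr (\<pi> - 1)) \<le> real t powr (\<pi> - 1)"
      proof eventually_elim
        case (elim \<omega>)
        have "running_max (walk \<xi>) i \<omega> \<le> real t"
          using elim by (intro running_max_least) (auto dest!: abs_le_D1)
        moreover have "running_max (walk \<xi>) i \<omega> \<ge> 0"
          using running_max_upper[of 0 i "walk \<xi>" \<omega>] by simp
        ultimately show ?case
          using \<open>\<pi> > 1\<close> by (auto intro: powr_mono2)
      qed
    qed measurable
    have int2: "integrable P (\<xi> (Suc i))"
    proof (rule integrable_const_bound)
      show "AE \<omega> in P. norm (\<xi> (Suc i) \<omega>) \<le> 1"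
        using step_val[of "Suc i"] by (auto elim!: eventually_mono)
    qed (simp add: step_meas)
    have "expectation (\<lambda>\<omega>. running_max (walk \<xi>) i \<omega> powr (\<pi> - 1) * \<xi> (Suc i) \<omega>)
        = expectation (\<lambda>\<omega>. running_max (walk \<xi>) i \<omega> powr (\<pi> - 1)) * expectation (\<xi> (Suc i))"
      using ind int1 int2 by (rule indep_var_lebesgue_integral)
    also have "expectation (\<xi> (Suc i)) = p - q"
      using expectation_three_valued[OF step_meas step_val, of "Suc i"] law by simp
    finally show ?thesis
      using \<open>p \<ge> q\<close> by simp
  qed
  show ?thesis
    using \<open>\<pi> > 1\<close> walk_meas walk_bdd incr
    by (intro Doob_Lp_running_max[where B = "real t"]) auto
qed

end
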